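(* Let $I=[0,1]$ and let $K(I)$ be the space of nonempty compact subsets of $I$. There do not exist uncountably many Borel measurable selector functions of bounded Borel rank for $K(I)$ which select distinct points within any uncountable compact set. That is, there do not exist an ordinal $\alpha<\omega_1$ and an uncountable family $\mathcal F$ of Borel measurable functions $f\colon K(I)\to I$, each of Borel rank at most $\alpha$, such that $f(C)\in C$ for all $f\in\mathcal F$ and $C\in K(I)$, and $f(C)\neq g(C)$ for all distinct $f,g\in\mathcal F$ and every uncountable $C\in K(I)$.
   Context: $K(I)$ carries its usual (Vietoris, equivalently Hausdorff metric) topology. A Borel measurable function $f\colon K(I)\to I$ has Borel rank at most $\alpha$, where $1\le\alpha<\omega_1$, if $f^{-1}(O)$ is a $\boldsymbol{\Sigma}^0_\alpha$ set for every open $O\subseteq I$. The statement is a theorem of ZFC. *)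

theory Defs
  imports "HOL-Analysis.Analysis" "HOL-Library.Countable_Set_Type"
begin

section \<open>The ordinals below \<open>\<omega>\<^sub>1\<close>\<close>

text \<open>
  The relation \<^term>\<open>cardSuc natLeq\<close> is a well-order of type \<open>\<omega>\<^sub>1\<close>, the cardinal successor of
  \<open>\<omega>\<close>. The elements of its field therefore represent exactly the countable ordinals, ordered
  in the usual way.
\<close>

lemma cardSuc_natLeq_Well_order: "Well_order (cardSuc natLeq)"
  using cardSuc_Card_order[OF natLeq_Card_order] by (simp add: card_order_on_def)

lemma cardSuc_natLeq_infinite: "infinite (Field (cardSuc natLeq))"
  using Cinfinite_cardSuc[OF natLeq_Cinfinite] by (simp add: cinfinite_def)

typedef omega1 = "Field (cardSuc natLeq)"
  using infinite_imp_nonempty[OF cardSuc_natLeq_infinite] by blast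

instantiation omega1 :: wellorder
begin

definition less_eq_omega1 :: "omega1 \<Rightarrow> omega1 \<Rightarrow> bool" where
  "\<alpha> \<le> \<beta> \<longleftrightarrow> (Rep_omega1 \<alpha>, Rep_omega1 \<beta>) \<in> cardSuc natLeq"

definition less_omega1 :: "omega1 \<Rightarrow> omega1 \<Rightarrow> bool" where
  "\<alpha> < \<beta> \<longleftrightarrow> \<alpha> \<le> \<beta> \<and> \<alpha> \<noteq> (\<beta>::omega1)"

instance
proof -
  let ?r = "cardSuc natLeq"
  have lin: "Linear_order ?r" and wf: "wf (?r - Id)"
    using cardSuc_natLeq_Well_order by (auto simp: well_order_on_def)
  have refl: "refl_on (Field ?r) ?r" and trans: "trans ?r" and antisym: "antisym ?r"
    and total: "total_on (Field ?r) ?r"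
    using lin by (auto simp: linear_order_on_def partial_order_on_def preorder_on_def)
  have rep: "Rep_omega1 \<alpha> \<in> Field ?r" for \<alpha>
    by (rule Rep_omega1)
  have le_refl: "\<alpha> \<le> \<alpha>" for \<alpha> :: omega1
    using refl rep by (auto simp: less_eq_omega1_def refl_on_def)
  have le_antisym: "\<alpha> = \<beta>" if "\<alpha> \<le> \<beta>" "\<beta> \<le> \<alpha>" for \<alpha> \<beta> :: omega1
    using antisymD[OF antisym] that by (simp add: less_eq_omega1_def flip: Rep_omega1_inject)
  have wf': "wf {(\<alpha>, \<beta>). \<alpha> < (\<beta> :: omega1)}"
    by (rule wf_subset[OF wf_inv_image[OF wf, of Rep_omega1]])
      (auto simp: less_omega1_def less_eq_omega1_def inv_image_def Rep_omega1_inject)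
  show "OFCLASS(omega1, wellorder_class)"
  proof
    fix \<alpha> \<beta> \<gamma> :: omega1 and P
    show "\<alpha> < \<beta> \<longleftrightarrow> \<alpha> \<le> \<beta> \<and> \<not> \<beta> \<le> \<alpha>"
      using le_refl le_antisym by (auto simp: less_omega1_def)
    show "\<alpha> \<le> \<alpha>" by (rule le_refl)
    show "\<alpha> \<le> \<gamma>" if "\<alpha> \<le> \<beta>" "\<beta> \<le> \<gamma>"
      using trans that unfolding less_eq_omega1_def by (rule transD)
    show "\<alpha> = \<beta>" if "\<alpha> \<le> \<beta>" "\<beta> \<le> \<alpha>"
      using that by (rule le_antisym)
    show "\<alpha> \<le> \<beta> \<or> \<beta> \<le> \<alpha>"
      using total rep le_refl[of \<alpha>] unfolding less_eq_omega1_def total_on_def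
      by (metis Rep_omega1_inject)
    show "P \<alpha>" if "\<And>\<xi>. (\<And>\<eta>. \<eta> < \<xi> \<Longrightarrow> P \<eta>) \<Longrightarrow> P \<xi>"
      using wf' that by (rule wf_induct_rule) auto
  qed
qed

end

instantiation omega1 :: "{zero, one}"
begin

definition zero_omega1 :: omega1 where "(0::omega1) = (LEAST \<alpha>. True)"

definition one_omega1 :: omega1 where "(1::omega1) = (LEAST \<alpha>. \<alpha> \<noteq> 0)"

instance ..

end

lemma uncountable_omega1:
  includes cardinal_syntax
  shows "uncountable (UNIV :: omega1 set)"
proof
  assume "countable (UNIV :: omega1 set)"
  then have "countable (range Rep_omega1)"
    by (rule countable_image)
  moreover have "range Rep_omega1 = Field (cardSuc natLeq)"
    using type_definition.Rep_range[OF type_definition_omega1] .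
  ultimately have "|Field (cardSuc natLeq)| \<le>o natLeq"
    by (simp add: countable_card_le_natLeq)
  then show False
    using cardSuc_greater[OF natLeq_Card_order]
      card_of_Field_ordIso[OF cardSuc_Card_order[OF natLeq_Card_order]]
    by (meson not_ordLess_ordLeq ordIso_iff_ordLeq ordLeq_transitive)
qed

lemma countable_below_omega1:
  includes cardinal_syntax
  shows "countable {\<beta>. \<beta> < (\<alpha> :: omega1)}"
proof -
  let ?r = "cardSuc natLeq"
  have "|underS ?r (Rep_omega1 \<alpha>)| <o ?r"
    by (rule card_of_underS[OF cardSuc_Card_order[OF natLeq_Card_order] Rep_omega1])
  then have "|underS ?r (Rep_omega1 \<alpha>)| \<le>o natLeq"
    using cardSuc_ordLeq_ordLess[OF natLeq_Card_order card_of_Card_order] by blast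
  then have "countable (underS ?r (Rep_omega1 \<alpha>))"
    by (simp add: countable_card_le_natLeq)
  moreover have "Rep_omega1 ` {\<beta>. \<beta> < \<alpha>} \<subseteq> underS ?r (Rep_omega1 \<alpha>)"
    by (auto simp: underS_def less_omega1_def less_eq_omega1_def Rep_omega1_inject)
  ultimately have "countable (Rep_omega1 ` {\<beta>. \<beta> < \<alpha>})"
    using countable_subset by blast
  then show ?thesis
    by (rule countable_image_inj_on) (simp add: inj_on_def Rep_omega1_inject)
qed

lemma zero_le_omega1: "(0::omega1) \<le> \<alpha>"
  unfolding zero_omega1_def by (rule Least_le) simp

lemma one_le_omega1_iff: "1 \<le> \<alpha> \<longleftrightarrow> \<alpha> \<noteq> (0::omega1)"
proof
  have "\<exists>\<beta>::omega1. \<beta> \<noteq> 0"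
    using uncountable_omega1 by (metis UNIV_eq_I countable_empty countable_insert insertI1)
  then have "(1::omega1) \<noteq> 0"
    unfolding one_omega1_def by (rule LeastI_ex)
  then show "\<alpha> \<noteq> 0" if "1 \<le> \<alpha>"
    using that zero_le_omega1[of 1] by auto
  show "1 \<le> \<alpha>" if "\<alpha> \<noteq> 0"
    unfolding one_omega1_def using that by (rule Least_le)
qed


section \<open>The Borel hierarchy and Borel measurable functions\<close>

definition borel_algebra :: "'a topology \<Rightarrow> 'a measure" where
  "borel_algebra X = sigma (topspace X) {U. openin X U}"

inductive Sigma0 :: "'a topology \<Rightarrow> omega1 \<Rightarrow> 'a set \<Rightarrow> bool"
  and Pi0 :: "'a topology \<Rightarrow> omega1 \<Rightarrow> 'a set \<Rightarrow> bool"
  for X :: "'a topology"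
where
  Sigma0_open: "openin X U \<Longrightarrow> Sigma0 X 1 U"
| Sigma0_Union: "1 < \<alpha> \<Longrightarrow> (\<And>n::nat. 1 \<le> \<beta> n \<and> \<beta> n < \<alpha> \<and> Pi0 X (\<beta> n) (A n)) \<Longrightarrow> Sigma0 X \<alpha> (\<Union>n. A n)"
| Pi0_compl: "Sigma0 X \<alpha> A \<Longrightarrow> Pi0 X \<alpha> (topspace X - A)"

definition borel_rank_le :: "'a topology \<Rightarrow> 'b topology \<Rightarrow> omega1 \<Rightarrow> ('a \<Rightarrow> 'b) \<Rightarrow> bool" where
  "borel_rank_le X Y \<alpha> f \<longleftrightarrow> (\<forall>U. openin Y U \<longrightarrow> Sigma0 X \<alpha> (f -` U \<inter> topspace X))"


section \<open>The hyperspace of nonempty compact sets\<close>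

definition vietoris :: "'a topology \<Rightarrow> 'a set topology" where
  "vietoris X = topology_generated_by
     ((\<lambda>U. {C. compactin X C \<and> C \<noteq> {} \<and> C \<subseteq> U}) ` {U. openin X U} \<union>
      (\<lambda>U. {C. compactin X C \<and> C \<noteq> {} \<and> C \<inter> U \<noteq> {}}) ` {U. openin X U})"

lemma topspace_vietoris: "topspace (vietoris X) = {C. compactin X C \<and> C \<noteq> {}}"
proof
  show "topspace (vietoris X) \<subseteq> {C. compactin X C \<and> C \<noteq> {}}"
    by (auto simp: vietoris_def)
  have "C \<subseteq> topspace X" if "compactin X C" for C
    using that by (rule compactin_subset_topspace)
  then show "{C. compactin X C \<and> C \<noteq> {}} \<subseteq> topspace (vietoris X)"
    by (force simp: vietoris_def)
qed

abbreviation unit_interval :: "real topology" where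
  "unit_interval \<equiv> top_of_set {0..1}"

abbreviation KI :: "real set topology" where
  "KI \<equiv> vietoris unit_interval"

lemma topspace_KI: "topspace KI = {C. compact C \<and> C \<noteq> {} \<and> C \<subseteq> {0..1}}"
  by (auto simp: topspace_vietoris compactin_subtopology)

end

theory Submission
  imports Defs
begin

text \<open>
  A Steel forcing argument. A tree \<open>T\<close> on the natural numbers is coded continuously by the compact
  set \<open>K\<^sub>T\<close>, the closure of points \<open>x\<^sub>s\<close> attached to its nodes. Equip trees with rank tags: a node is
  tagged by an element of \<open>(\<alpha> + 1) \<times> \<omega>\<close> (lexicographic) or by \<open>\<infinity>\<close>, and tags strictly decrease along
  the tree, except that \<open>\<infinity>\<close> may lie below \<open>\<infinity>\<close>. Tagged trees form a Baire space. If the root has an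
  ordinal tag, then \<open>T\<close> is well-founded and \<open>K\<^sub>T\<close> consists of the countably many points \<open>x\<^sub>s\<close>. So for
  every selector \<open>f\<close> in the family there are a basic open set \<open>N\<close> and a node \<open>s\<close> with
  \<open>f(K\<^sub>T) = x\<^sub>s\<close> for comeagerly many trees in \<open>N\<close>, and two selectors \<open>f \<noteq> g\<close> get the same pair
  \<open>(N, s)\<close>. Since \<open>f(K\<^sub>T) = x\<^sub>s\<close> is a \<open>\<Pi>\<^sup>0\<^sub>\<alpha>\<close> condition, it cannot tell tags at or above \<open>\<omega> \<cdot> \<alpha>\<close>
  apart: it still holds generically after replacing these tags by \<open>\<infinity>\<close>. But then \<open>K\<^sub>T\<close> is
  generically uncountable, while \<open>f(K\<^sub>T) = x\<^sub>s = g(K\<^sub>T)\<close>.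
\<close>

section \<open>Tagged trees\<close>

text \<open>\<open>Out\<close> marks the sequences that are not in the tree, and \<open>Fin \<gamma> n\<close> stands for the ordinal
  \<open>\<omega> \<cdot> \<gamma> + n\<close>.\<close>

datatype tag = Out | Fin omega1 nat | Infty

text \<open>The clauses for \<open>Out\<close> make the nodes with any other tag closed under
  initial segments, so they form a tree. \<open>Infty\<close> below \<open>Infty\<close> is what
  permits infinite branches.\<close>

definition tag_less :: "tag \<Rightarrow> tag \<Rightarrow> bool" where
  "tag_less u v \<longleftrightarrow> (case u of
      Out \<Rightarrow> True
    | Fin \<gamma> n \<Rightarrow> (case v of Out \<Rightarrow> False | Fin \<delta> m \<Rightarrow> \<gamma> < \<delta> \<or> \<gamma> = \<delta> \<and> n < m | Infty \<Rightarrow> True)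
    | Infty \<Rightarrow> v = Infty)"

lemma tag_less_simps [simp]:
  "tag_less Out v"
  "tag_less u Infty"
  "tag_less Infty v \<longleftrightarrow> v = Infty"
  "tag_less u Out \<longleftrightarrow> u = Out"
  "tag_less (Fin \<gamma> n) (Fin \<delta> m) \<longleftrightarrow> \<gamma> < \<delta> \<or> \<gamma> = \<delta> \<and> n < m"
  by (auto simp: tag_less_def split: tag.splits)

definition tag_ge :: "omega1 \<Rightarrow> tag \<Rightarrow> bool" where
  "tag_ge \<beta> u \<longleftrightarrow> u = Infty \<or> (\<exists>\<gamma>\<ge>\<beta>. \<exists>n. u = Fin \<gamma> n)"

text \<open>The retagging relation of Steel forcing: infinity and the ordinals from
  \<open>\<omega> \<cdot> \<beta>\<close> on become indistinguishable, while smaller tags stay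
  exact.\<close>

definition tag_sim :: "omega1 \<Rightarrow> tag \<Rightarrow> tag \<Rightarrow> bool" where
  "tag_sim \<beta> u v \<longleftrightarrow> u = v \<or> tag_ge \<beta> u \<and> tag_ge \<beta> v"

lemma tag_ge_simps [simp]:
  "\<not> tag_ge \<beta> Out" "tag_ge \<beta> Infty" "tag_ge \<beta> (Fin \<gamma> n) \<longleftrightarrow> \<beta> \<le> \<gamma>"
  by (auto simp: tag_ge_def)

lemma tag_sim_sym: "tag_sim \<beta> u v \<Longrightarrow> tag_sim \<beta> v u"
  by (auto simp: tag_sim_def)

lemma tag_sim_mono: "tag_sim \<beta> u v \<Longrightarrow> \<gamma> \<le> \<beta> \<Longrightarrow> tag_sim \<gamma> u v"
  by (auto simp: tag_sim_def tag_ge_def)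

text \<open>\<open>Out\<close> is never at or above a bound, so retagging leaves the underlying tree
  alone; the coded compact set depends on nothing else.\<close>

lemma tag_sim_Out: "tag_sim \<beta> u v \<Longrightarrow> u = Out \<longleftrightarrow> v = Out"
  by (auto simp: tag_sim_def)

text \<open>Finite sequences are stored in reverse: the children of \<open>s\<close> are the lists \<open>n # s\<close>.\<close>

definition tagged_trees :: "omega1 \<Rightarrow> (nat list \<Rightarrow> tag) set" where
  "tagged_trees w = {z. z [] \<noteq> Out \<and> (\<forall>s n. tag_less (z (n # s)) (z s)) \<and>
     (\<forall>s \<gamma> n. z s = Fin \<gamma> n \<longrightarrow> \<gamma> \<le> w)}"

text \<open>Finite stages exhausting all nodes. Bounding entries and length together keeps each
  stage finite and closed under passing to the parent.\<close>

definition node_box :: "nat \<Rightarrow> nat list set" where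
  "node_box k = {s. set s \<subseteq> {..<k} \<and> length s \<le> k}"

text \<open>Basic neighbourhoods for the product topology with discrete tags. Only the values of
  \<open>x\<close> on the box matter, so \<open>x\<close> itself may be any function.\<close>

definition cyl :: "omega1 \<Rightarrow> (nat list \<Rightarrow> tag) \<Rightarrow> nat \<Rightarrow> (nat list \<Rightarrow> tag) set" where
  "cyl w x k = {y \<in> tagged_trees w. \<forall>s\<in>node_box k. y s = x s}"

lemma finite_node_box: "finite (node_box k)"
  unfolding node_box_def by (rule finite_lists_length_le) simp

lemma Nil_in_node_box [simp]: "[] \<in> node_box k"
  by (simp add: node_box_def)

lemma node_box_tail: "n # s \<in> node_box k \<Longrightarrow> s \<in> node_box k"
  by (auto simp: node_box_def)

lemma node_box_mono: "k \<le> j \<Longrightarrow> node_box k \<subseteq> node_box j"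
  by (force simp: node_box_def)

lemma in_some_node_box: "\<exists>k. s \<in> node_box k"
proof
  show "s \<in> node_box (length s + Suc (Max (insert 0 (set s))))"
    by (auto simp: node_box_def less_Suc_eq_le trans_le_add2)
qed

lemma cyl_refl: "x \<in> tagged_trees w \<Longrightarrow> x \<in> cyl w x k"
  by (simp add: cyl_def)

lemma cyl_tagged: "y \<in> cyl w x k \<Longrightarrow> y \<in> tagged_trees w"
  by (simp add: cyl_def)

lemma cyl_mono: "y \<in> cyl w x k \<Longrightarrow> k \<le> j \<Longrightarrow> cyl w y j \<subseteq> cyl w x k"
  using node_box_mono[of k j] by (auto simp: cyl_def)

text \<open>Since \<open>w\<close> has countably many predecessors, there are countably many
  possible tags, and a cylinder is given by a level and finitely many tags.\<close>

lemma countable_cyls: "countable {W. \<exists>x\<in>tagged_trees w. \<exists>k. W = cyl w x k}"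
proof -
  let ?tags = "insert Out (insert Infty (case_prod Fin ` ({..w} \<times> UNIV)))"
  have "{..w} = insert w {\<beta>. \<beta> < w}"
    by auto
  then have "countable ?tags"
    using countable_below_omega1[of w] by simp
  then have "countable (Sigma UNIV (\<lambda>k. node_box k \<rightarrow>\<^sub>E ?tags))"
    by (intro countable_SIGMA countable_PiE) (auto simp: finite_node_box)
  moreover have "cyl w x k \<in> (\<lambda>(k, h). cyl w h k) ` Sigma UNIV (\<lambda>k. node_box k \<rightarrow>\<^sub>E ?tags)"
    if "x \<in> tagged_trees w" for x k
  proof (rule image_eqI[of _ _ "(k, restrict x (node_box k))"])
    have "x s \<in> ?tags" for s
      using that by (cases "x s") (force simp: tagged_trees_def)+
    then show "(k, restrict x (node_box k)) \<in> Sigma UNIV (\<lambda>k. node_box k \<rightarrow>\<^sub>E ?tags)"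
      by (auto simp del: insert_iff)
  qed (simp add: cyl_def)
  ultimately show ?thesis
    by (elim countable_subset[OF _ countable_image, rotated]) auto
qed


section \<open>Category forcing\<close>

text \<open>Density of the interior of \<open>G\<close>, not merely of \<open>G\<close>.\<close>

definition dense_in :: "omega1 \<Rightarrow> (nat list \<Rightarrow> tag) set \<Rightarrow> bool" where
  "dense_in w G \<longleftrightarrow>
     (\<forall>x\<in>tagged_trees w. \<forall>k. \<exists>y\<in>cyl w x k. \<exists>j\<ge>k. cyl w y j \<subseteq> G)"

text \<open>Comeagreness of \<open>S\<close> in \<open>W\<close>, read as a forcing relation with
  cylinders as conditions.\<close>

definition forces :: "omega1 \<Rightarrow> (nat list \<Rightarrow> tag) set \<Rightarrow> (nat list \<Rightarrow> tag) set \<Rightarrow> bool" where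
  "forces w W S \<longleftrightarrow> (\<exists>\<G>. countable \<G> \<and> (\<forall>G\<in>\<G>. dense_in w G) \<and> W \<inter> \<Inter>\<G> \<subseteq> S)"

lemma forces_subset: "W \<subseteq> S \<Longrightarrow> forces w W S"
  unfolding forces_def by (rule exI[of _ "{}"]) auto

lemma forces_mono: "forces w W S \<Longrightarrow> V \<subseteq> W \<Longrightarrow> S \<subseteq> S' \<Longrightarrow> forces w V S'"
  unfolding forces_def by (meson Int_mono order_refl order_trans)

lemma forces_INT:
  assumes "countable I" "\<And>i. i \<in> I \<Longrightarrow> forces w W (S i)"
  shows "forces w W (\<Inter>i\<in>I. S i)"
proof -
  obtain \<G> where "\<And>i. i \<in> I \<Longrightarrow> countable (\<G> i) \<and> (\<forall>G\<in>\<G> i. dense_in w G) \<and> W \<inter> \<Inter>(\<G> i) \<subseteq> S i"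
    using assms(2) unfolding forces_def by metis
  then show ?thesis
    unfolding forces_def using assms(1)
    by (intro exI[of _ "\<Union>i\<in>I. \<G> i"]) (auto, blast)
qed

lemma forces_Int: "forces w W S \<Longrightarrow> forces w W S' \<Longrightarrow> forces w W (S \<inter> S')"
  using forces_INT[of "UNIV :: bool set" w W "\<lambda>b. if b then S else S'"]
  by (auto simp: UNIV_bool Int_commute)

text \<open>This is the Baire category theorem for the space of tagged trees.\<close>

lemma forces_nonempty:
  assumes x: "x \<in> tagged_trees w" and f: "forces w (cyl w x k) S"
  shows "\<exists>z\<in>cyl w x k. z \<in> S"
proof -
  obtain \<G>' where "countable \<G>'" "\<forall>G\<in>\<G>'. dense_in w G" "cyl w x k \<inter> \<Inter>\<G>' \<subseteq> S"
    using f unfolding forces_def by blast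
  \<comment> \<open>Adding \<open>UNIV\<close> makes the family nonempty, so that it can be
    enumerated.\<close>
  moreover have "dense_in w UNIV"
    by (auto simp: dense_in_def intro: cyl_refl)
  ultimately obtain \<G> where \<G>: "countable \<G>" "\<G> \<noteq> {}" "\<And>G. G \<in> \<G> \<Longrightarrow> dense_in w G"
      "cyl w x k \<inter> \<Inter>\<G> \<subseteq> S"
    by (metis Inter_insert Int_UNIV_left countable_insert insert_iff insert_not_empty)
  define G where "G = from_nat_into \<G>"
  have ran: "range G = \<G>"
    unfolding G_def by (rule range_from_nat_into[OF \<G>(2,1)])
  then have dG: "dense_in w (G n)" for n
    using \<G>(3) by blast
  \<comment> \<open>A pair \<open>p n\<close> stands for the cylinder with centre
    \<open>fst (p n)\<close> and level \<open>snd (p n)\<close>. The bound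
    \<open>n \<le> snd (p n)\<close> makes the boxes exhaust all nodes, so that the nested cylinders
    determine a point.\<close>
  have "\<exists>p. \<forall>n. (fst (p n) \<in> cyl w x k \<and> k \<le> snd (p n) \<and> n \<le> snd (p n)) \<and>
      (fst (p (Suc n)) \<in> cyl w (fst (p n)) (snd (p n)) \<and> snd (p n) \<le> snd (p (Suc n)) \<and>
       cyl w (fst (p (Suc n))) (snd (p (Suc n))) \<subseteq> G n)"
  proof (rule dependent_nat_choice)
    show "\<exists>p. fst p \<in> cyl w x k \<and> k \<le> snd p \<and> 0 \<le> snd p"
      using cyl_refl[OF x] by (intro exI[of _ "(x, k)"]) simp
  next
    fix p n assume p: "fst p \<in> cyl w x k \<and> k \<le> snd p \<and> n \<le> snd p"
    obtain y j where y: "y \<in> cyl w (fst p) (snd p)" "j \<ge> snd p" "cyl w y j \<subseteq> G n"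
      using dG[of n] p unfolding dense_in_def by (meson cyl_tagged)
    have "y \<in> cyl w x k"
      using y(1) p cyl_mono[of "fst p" w x k "snd p"] by blast
    moreover have "cyl w y (Suc j) \<subseteq> G n"
      using cyl_mono[OF cyl_refl[OF cyl_tagged[OF y(1)]], of j "Suc j"] y(3) by simp
    ultimately show "\<exists>q. (fst q \<in> cyl w x k \<and> k \<le> snd q \<and> Suc n \<le> snd q) \<and>
        fst q \<in> cyl w (fst p) (snd p) \<and> snd p \<le> snd q \<and> cyl w (fst q) (snd q) \<subseteq> G n"
      using y p by (intro exI[of _ "(y, Suc j)"]) auto
  qed
  then obtain p where p: "\<And>n. fst (p n) \<in> cyl w x k" "\<And>n. k \<le> snd (p n)" "\<And>n. n \<le> snd (p n)"
      "\<And>n. fst (p (Suc n)) \<in> cyl w (fst (p n)) (snd (p n))" "\<And>n. snd (p n) \<le> snd (p (Suc n))"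
      "\<And>n. cyl w (fst (p (Suc n))) (snd (p (Suc n))) \<subseteq> G n"
    by blast
  define X K where "X n = fst (p n)" and "K n = snd (p n)" for n
  have dec: "cyl w (X m) (K m) \<subseteq> cyl w (X n) (K n)" if "n \<le> m" for n m
    using that
  proof (induction rule: dec_induct)
    case (step m)
    then show ?case
      using cyl_mono[OF p(4)[of m] p(5)[of m]] by (simp add: X_def K_def)
  qed simp
  have XT: "X n \<in> tagged_trees w" for n
    using p(1) cyl_tagged unfolding X_def by blast
  have agree: "X m s = X n s" if "s \<in> node_box (K n)" "n \<le> m" for n m s
    using dec[OF that(2)] cyl_refl[OF XT] that(1) unfolding cyl_def by blast
  have "\<exists>n. s \<in> node_box (K n)" for s
    using in_some_node_box[of s] node_box_mono p(3) unfolding K_def by blast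
  then obtain N where N: "\<And>s. s \<in> node_box (K (N s))"
    by metis
  \<comment> \<open>The tag at \<open>s\<close> is frozen once \<open>s\<close> has entered a box,
    so any later stage gives the same value.\<close>
  define z where "z s = X (N s) s" for s
  have zX: "z s = X m s" if "s \<in> node_box (K m)" for s m
    unfolding z_def using agree[OF that] agree[OF N] by (metis nat_le_linear)
  have zX': "z s = X m s" if "N s \<le> m" for s m
    unfolding z_def using agree[OF N that] by simp
  have "z \<in> tagged_trees w"
    unfolding tagged_trees_def
  proof (intro CollectI conjI allI impI)
    show "z [] \<noteq> Out"
      using XT by (simp add: z_def tagged_trees_def)
    show "tag_less (z (n # s)) (z s)" for s n
      using zX'[of s "max (N s) (N (n # s))"] zX'[of "n # s" "max (N s) (N (n # s))"]
        XT[of "max (N s) (N (n # s))"] by (auto simp: tagged_trees_def)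
    show "\<gamma> \<le> w" if "z s = Fin \<gamma> n" for s \<gamma> n
      using that XT unfolding z_def tagged_trees_def by blast
  qed
  then have zc: "z \<in> cyl w (X n) (K n)" for n
    using zX by (simp add: cyl_def)
  then have "z \<in> G n" for n
    using p(6)[of n] unfolding X_def K_def by blast
  moreover have "z \<in> cyl w x k"
    using zc[of 0] cyl_mono[OF p(1)[of 0] p(2)[of 0]] unfolding X_def K_def by blast
  ultimately show ?thesis
    using \<G>(4) ran by blast
qed

text \<open>Only countably many cylinders force \<open>S\<close>, so their witnesses merge into one
  countable family. The union of these cylinders is dense inside \<open>cyl w x k\<close>; adding
  \<open>- cyl w x k\<close> makes it dense everywhere.\<close>

lemma forces_locally:
  assumes loc: "\<And>y j. y \<in> cyl w x k \<Longrightarrow> k \<le> j \<Longrightarrow>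
      \<exists>z\<in>cyl w y j. \<exists>i\<ge>j. forces w (cyl w z i) S"
  shows "forces w (cyl w x k) S"
proof -
  define \<W> where "\<W> = {W. (\<exists>z\<in>tagged_trees w. \<exists>i. W = cyl w z i) \<and> forces w W S}"
  have "countable \<W>"
    unfolding \<W>_def by (rule countable_subset[OF _ countable_cyls[of w]]) auto
  moreover have "\<exists>\<G>. \<forall>W\<in>\<W>. countable (\<G> W) \<and> (\<forall>G\<in>\<G> W. dense_in w G) \<and> W \<inter> \<Inter>(\<G> W) \<subseteq> S"
    unfolding \<W>_def forces_def by (intro bchoice) auto
  then obtain \<G> where \<G>: "\<forall>W\<in>\<W>. countable (\<G> W) \<and> (\<forall>G\<in>\<G> W. dense_in w G) \<and> W \<inter> \<Inter>(\<G> W) \<subseteq> S"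
    by blast
  moreover have "dense_in w (- cyl w x k \<union> \<Union>\<W>)"
    unfolding dense_in_def
  proof (intro ballI allI)
    fix y j assume y: "y \<in> tagged_trees w"
    show "\<exists>z\<in>cyl w y j. \<exists>i\<ge>j. cyl w z i \<subseteq> - cyl w x k \<union> \<Union>\<W>"
    proof (cases "y \<in> cyl w x k")
      case True
      then obtain z i where z: "z \<in> cyl w y (max j k)" "i \<ge> max j k" "forces w (cyl w z i) S"
        using loc[of y "max j k"] by auto
      then have "cyl w z i \<in> \<W>"
        unfolding \<W>_def using cyl_tagged by blast
      moreover have "z \<in> cyl w y j"
        using z(1) cyl_mono[of y w y j "max j k"] cyl_refl[OF y] by auto
      ultimately show ?thesis
        using z(2) by (metis Sup_upper le_supI2 max.bounded_iff)
    next
      case False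
      then have "cyl w y (max j k) \<subseteq> - cyl w x k"
        using y node_box_mono[of k "max j k"] unfolding cyl_def by fastforce
      then show ?thesis
        using cyl_refl[OF y] by (metis le_supI1 max.cobounded1)
    qed
  qed
  ultimately show ?thesis
    unfolding forces_def
    by (intro exI[of _ "insert (- cyl w x k \<union> \<Union>\<W>) (\<Union>W\<in>\<W>. \<G> W)"]) (auto, blast)
qed

text \<open>The property of Baire in forcing form: every condition has an extension in which
  \<open>S\<close> is comeagre or meagre.\<close>

definition decided :: "omega1 \<Rightarrow> (nat list \<Rightarrow> tag) set \<Rightarrow> bool" where
  "decided w S \<longleftrightarrow> (\<forall>x\<in>tagged_trees w. \<forall>k. \<exists>y\<in>cyl w x k. \<exists>j\<ge>k.
     forces w (cyl w y j) S \<or> forces w (cyl w y j) (- S))"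

text \<open>If no extension forced \<open>S\<close>, then extensions forcing \<open>- S\<close>
  would be dense below the cylinder, and \<open>forces_locally\<close> would make the cylinder
  itself force \<open>- S\<close>.\<close>

lemma not_forces_Compl:
  assumes S: "decided w S" and n: "\<not> forces w (cyl w x k) (- S)"
  shows "\<exists>y\<in>cyl w x k. \<exists>j\<ge>k. forces w (cyl w y j) S"
proof (rule ccontr)
  assume H: "\<not> ?thesis"
  have "forces w (cyl w x k) (- S)"
  proof (rule forces_locally)
    fix y j assume y: "y \<in> cyl w x k" "k \<le> j"
    obtain z i where z: "z \<in> cyl w y j" "i \<ge> j"
        "forces w (cyl w z i) S \<or> forces w (cyl w z i) (- S)"
      using S cyl_tagged[OF y(1)] unfolding decided_def by blast
    moreover have "z \<in> cyl w x k"
      using z(1) cyl_mono[OF y] by blast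
    ultimately show "\<exists>z\<in>cyl w y j. \<exists>i\<ge>j. forces w (cyl w z i) (- S)"
      using H y(2) by (meson order_trans)
  qed
  then show False
    using n by simp
qed

text \<open>Either some \<open>S n\<close> is not meagre in the cylinder, and then an extension
  forces it, or all are meagre and so is their union.\<close>

lemma decided_UN:
  assumes "\<And>n::nat. decided w (S n)"
  shows "decided w (\<Union>n. S n)"
  unfolding decided_def
proof (intro ballI allI)
  fix x k assume x: "x \<in> tagged_trees w"
  show "\<exists>y\<in>cyl w x k. \<exists>j\<ge>k. forces w (cyl w y j) (\<Union>n. S n) \<or> forces w (cyl w y j) (- (\<Union>n. S n))"
  proof (cases "\<exists>n. \<not> forces w (cyl w x k) (- S n)")
    case True
    then show ?thesis
      using not_forces_Compl[OF assms] by (meson UN_upper UNIV_I forces_mono order_refl)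
  next
    case False
    then have "forces w (cyl w x k) (\<Inter>n. - S n)"
      by (intro forces_INT) auto
    then show ?thesis
      using cyl_refl[OF x] by (auto simp: Compl_UN)
  qed
qed


section \<open>Retagging\<close>

text \<open>New nodes of \<open>y\<close> whose tag is at least \<open>\<omega> \<cdot> (\<gamma> + 1)\<close> are moved down into the block
  \<open>\<omega> \<cdot> \<gamma> + M, \<omega> \<cdot> \<gamma> + M + 1, \<dots>\<close>, above all other tags used in that block and still below
  every tag that is at least \<open>\<omega> \<cdot> \<beta>\<close>.\<close>

lemma retag:
  assumes x: "x \<in> tagged_trees w" and y: "y \<in> cyl w x' k"
    and sim: "\<And>s. s \<in> node_box k \<Longrightarrow> tag_sim \<beta> (x s) (x' s)"
    and "\<gamma> < \<beta>" "\<beta> \<le> w" "k \<le> j"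
  shows "\<exists>z\<in>cyl w x k. \<forall>s\<in>node_box j. tag_sim \<gamma> (z s) (y s)"
proof -
  have yT: "y \<in> tagged_trees w" and yx: "\<And>s. s \<in> node_box k \<Longrightarrow> y s = x' s"
    using y by (auto simp: cyl_def)
  have yless: "tag_less (y (n # s)) (y s)" for n s
    using yT by (simp add: tagged_trees_def)
  have xless: "tag_less (x (n # s)) (x s)" for n s
    using x by (simp add: tagged_trees_def)
  have "finite {n. \<exists>s\<in>node_box j. y s = Fin \<gamma> n}"
  proof (rule finite_subset)
    show "{n. \<exists>s\<in>node_box j. y s = Fin \<gamma> n} \<subseteq> (\<lambda>s. case y s of Fin \<delta> n \<Rightarrow> n | _ \<Rightarrow> 0) ` node_box j"
      by force
  qed (simp add: finite_node_box)
  \<comment> \<open>The block index \<open>M\<close> lies above every tag already used in block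
    \<open>\<gamma>\<close> inside the box.\<close>
  then obtain M where M: "\<And>s n. s \<in> node_box j \<Longrightarrow> y s = Fin \<gamma> n \<Longrightarrow> n < M"
    unfolding finite_nat_set_iff_bounded by blast
  define huge where "huge u \<longleftrightarrow> u = Infty \<or> (\<exists>\<delta>>\<gamma>. \<exists>n. u = Fin \<delta> n)" for u
  \<comment> \<open>The summand \<open>j - length s\<close> makes the lowered tags decrease along
    branches, and cutting off with \<open>Out\<close> outside the box means that only finitely many
    nodes need care.\<close>
  define z where "z s = (if s \<in> node_box k then x s else if s \<notin> node_box j then Out
      else if huge (y s) then Fin \<gamma> (M + (j - length s)) else y s)" for s
  have "z \<in> tagged_trees w"
    unfolding tagged_trees_def
  proof (intro CollectI conjI allI impI)
    show "z [] \<noteq> Out"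
      using x by (simp add: z_def tagged_trees_def)
    show "\<delta> \<le> w" if "z s = Fin \<delta> n" for s \<delta> n
    proof -
      have "x s = Fin \<delta> n \<or> y s = Fin \<delta> n \<or> \<delta> = \<gamma>"
        using that by (auto simp: z_def split: if_splits)
      then show ?thesis
        using x yT \<open>\<gamma> < \<beta>\<close> \<open>\<beta> \<le> w\<close> unfolding tagged_trees_def by fastforce
    qed
    fix s n
    consider "n # s \<in> node_box k" | "n # s \<notin> node_box j"
      | (new) "n # s \<in> node_box j" "n # s \<notin> node_box k" "s \<in> node_box j" "s \<notin> node_box k"
      | (mixed) "n # s \<in> node_box j" "n # s \<notin> node_box k" "s \<in> node_box k"
      using node_box_tail by blast
    then show "tag_less (z (n # s)) (z s)"
    proof cases
      case 1
      then show ?thesis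
        using node_box_tail[OF 1] xless by (simp add: z_def)
    next
      case 2
      then show ?thesis
        using node_box_mono[OF \<open>k \<le> j\<close>] by (auto simp: z_def)
    next
      case new
      \<comment> \<open>Truncated subtraction drops strictly from \<open>s\<close> to its child only
        under this bound.\<close>
      have "length s < j"
        using new(1) by (simp add: node_box_def)
      then show ?thesis
        using new yless[of n s] M[OF new(1)] M[OF new(3)]
        by (cases "y (n # s)"; cases "y s") (force simp: z_def huge_def)+
    next
      \<comment> \<open>If the parent's tag was changed, then \<open>x s\<close> is at or above
        \<open>\<omega> \<cdot> \<beta>\<close>, hence above all of block \<open>\<gamma>\<close>.
        Otherwise \<open>x s = x' s\<close>, and the child's tag is either kept or lowered into
        block \<open>\<gamma>\<close>, below \<open>x s\<close>.\<close>
      case mixed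
      have "tag_less (y (n # s)) (x' s)"
        using yless[of n s] yx[OF mixed(3)] by simp
      then show ?thesis
        using mixed sim[OF mixed(3)] \<open>\<gamma> < \<beta>\<close>
        by (cases "y (n # s)"; cases "x s"; cases "x' s")
          (auto simp: z_def huge_def tag_sim_def)
    qed
  qed
  then have "z \<in> cyl w x k"
    by (simp add: cyl_def z_def)
  moreover have "tag_sim \<gamma> (z s) (y s)" if "s \<in> node_box j" for s
    using that sim[of s] yx[of s] tag_sim_mono[of \<beta> _ _ \<gamma>] \<open>\<gamma> < \<beta>\<close>
    by (auto simp: z_def huge_def tag_sim_def)
  ultimately show ?thesis
    by blast
qed


section \<open>The compact set coded by a tree\<close>

text \<open>Child \<open>n\<close> of a node with point \<open>p\<close> and width \<open>d\<close>
  occupies the interval from \<open>p + d / 2 ^ (n + 1)\<close> to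
  \<open>p + d * (3 / 4) / 2 ^ n\<close>. Sibling intervals are thus disjoint, and they shrink to
  \<open>p\<close> as \<open>n\<close> grows.\<close>

primrec node_width :: "nat list \<Rightarrow> real" where
  "node_width [] = 1"
| "node_width (n # s) = node_width s / 2 ^ (n + 2)"

primrec node_point :: "nat list \<Rightarrow> real" where
  "node_point [] = 0"
| "node_point (n # s) = node_point s + node_width s / 2 ^ (n + 1)"

definition node_interval :: "nat list \<Rightarrow> real set" where
  "node_interval s = {node_point s .. node_point s + node_width s}"

lemma node_width_pos: "0 < node_width s"
  by (induction s) auto

lemma node_width_le: "node_width s \<le> (1/2) ^ length s"
proof (induction s)
  case (Cons n s)
  have "(2::real) ^ 1 \<le> 2 ^ (n + 2)"
    by (intro power_increasing) auto
  then have "node_width s / 2 ^ (n + 2) \<le> node_width s / 2"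
    using node_width_pos[of s] by (intro divide_left_mono) auto
  then show ?case
    using Cons by simp
qed simp

lemma child_end:
  "node_point (n # s) + node_width (n # s) = node_point s + node_width s * (3 / 4) / 2 ^ n"
  by (simp add: power_add field_simps)

lemma node_interval_Cons: "node_interval (n # s) \<subseteq> node_interval s"
proof -
  have "node_width s * (3 / 4) / 2 ^ n \<le> node_width s / 1"
    using node_width_pos[of s] by (intro frac_le) auto
  then show ?thesis
    using child_end[of n s] node_width_pos[of s] by (auto simp: node_interval_def)
qed

lemma node_interval_append: "node_interval (u @ s) \<subseteq> node_interval s"
  using node_interval_Cons by (induction u) auto

lemma node_point_in: "node_point s \<in> node_interval s"
  using node_width_pos[of s] by (simp add: node_interval_def)

lemma node_point_append: "node_point (u @ s) \<in> node_interval s"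
  using node_point_in node_interval_append by blast

lemma node_point_unit: "node_point s \<in> {0..1}"
  using node_point_append[of s "[]"] by (simp add: node_interval_def)

lemma node_interval_disjoint:
  assumes "n < m"
  shows "node_interval (n # s) \<inter> node_interval (m # s) = {}"
proof -
  have "(2::real) ^ Suc n \<le> 2 ^ m"
    using assms by (intro power_increasing) auto
  then have "node_width s * (3 / 4) / 2 ^ m \<le> node_width s * (3 / 4) / 2 ^ Suc n"
    using node_width_pos[of s] by (intro divide_left_mono) auto
  also have "\<dots> < node_width s / 2 ^ (n + 1)"
    using node_width_pos[of s] by (simp add: field_simps)
  finally show ?thesis
    using child_end[of m s] by (auto simp: node_interval_def)
qed

definition tree_set :: "(nat list \<Rightarrow> tag) \<Rightarrow> real set" where
  "tree_set z = closure (node_point ` {s. z s \<noteq> Out})"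

lemma tree_set_KI:
  assumes "z \<in> tagged_trees w"
  shows "tree_set z \<in> topspace KI"
proof -
  have "tree_set z \<subseteq> {0..1}"
    unfolding tree_set_def using node_point_unit by (intro closure_minimal) auto
  moreover have "compact (tree_set z)"
    unfolding tree_set_def compact_closure
    using node_point_unit by (intro bounded_subset[OF bounded_closed_interval[of 0 1]]) auto
  moreover have "tree_set z \<noteq> {}"
    using assms by (auto simp: tree_set_def tagged_trees_def)
  ultimately show ?thesis
    by (simp add: topspace_KI)
qed

section \<open>Continuity of the coding map\<close>

lemma prefix_closed:
  assumes "z \<in> tagged_trees w" "z (u @ s) \<noteq> Out"
  shows "z s \<noteq> Out"
  using assms(2)
proof (induction u)
  case (Cons n u)
  have "tag_less (z (n # u @ s)) (z (u @ s))"
    using assms(1) by (simp add: tagged_trees_def)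
  then show ?case
    using Cons by (metis append_Cons tag_less_simps(4))
qed simp

lemma leaves_node_box: "t \<notin> node_box j \<Longrightarrow> \<exists>u n s. t = u @ n # s \<and> s \<in> node_box j \<and> n # s \<notin> node_box j"
proof (induction t)
  case (Cons n t)
  then show ?case
    by (cases "t \<in> node_box j") (metis append_Nil, metis append_Cons)
qed simp

text \<open>The branch to \<open>t\<close> leaves the box at some \<open>s\<close>. Either
  \<open>s\<close> has length \<open>j\<close>, and its interval is short, or the next entry is at
  least \<open>j\<close>, and that child's interval lies close to the left end of the interval of
  \<open>s\<close>.\<close>

lemma node_point_near_node_box:
  "\<exists>u s. t = u @ s \<and> s \<in> node_box j \<and> \<bar>node_point t - node_point s\<bar> \<le> (1/2) ^ j"
proof (cases "t \<in> node_box j")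
  case True
  then show ?thesis
    by (intro exI[of _ "[]"] exI[of _ t]) auto
next
  case False
  then obtain u n s where t: "t = u @ n # s" "s \<in> node_box j" "n # s \<notin> node_box j"
    using leaves_node_box by blast
  have "\<bar>node_point t - node_point s\<bar> \<le> (1/2) ^ j"
  proof (cases "length s = j")
    case True
    then show ?thesis
      using node_point_append[of "u @ [n]" s] node_width_le[of s] t(1)
      by (auto simp: node_interval_def)
  next
    case False
    then have "j \<le> n"
      using t(2,3) by (force simp: node_box_def)
    have "node_width s * (3 / 4) \<le> 1"
      using node_width_le[of s] power_le_one[of "1/2 :: real" "length s"] node_width_pos[of s]
      by simp
    moreover have "(2::real) ^ j \<le> 2 ^ n"
      using \<open>j \<le> n\<close> by (intro power_increasing) auto
    ultimately have "node_width s * (3 / 4) / 2 ^ n \<le> 1 / 2 ^ j"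
      by (intro frac_le) auto
    moreover have "node_point t \<in> node_interval (n # s)"
      using t(1) node_point_append by simp
    moreover have "node_point s \<le> node_point (n # s)"
      using node_width_pos[of s] by simp
    ultimately show ?thesis
      using child_end[of n s] by (simp add: node_interval_def power_one_over del: node_point.simps)
  qed
  then show ?thesis
    using t by (intro exI[of _ "u @ [n]"] exI[of _ s]) auto
qed

text \<open>For inclusion in an open set, every node point is close to the point of an ancestor in
  the box, where the two trees agree. For meeting an open set, a single node of \<open>z\<close> is
  a witness, since node points are dense in the code.\<close>

lemma tree_set_openin:
  assumes z: "z \<in> tagged_trees w" and U: "openin KI U" "tree_set z \<in> U"
  shows "\<exists>j. \<forall>y\<in>tagged_trees w. (\<forall>s\<in>node_box j. y s = Out \<longleftrightarrow> z s = Out) \<longrightarrow> tree_set y \<in> U"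
proof -
  define near where "near j y \<longleftrightarrow> y \<in> tagged_trees w \<and> (\<forall>s\<in>node_box j. y s = Out \<longleftrightarrow> z s = Out)"
    for j and y :: "nat list \<Rightarrow> tag"
  have near_mono: "near i y" if "near j y" "i \<le> j" for i j y
    using that node_box_mono[of i j] by (auto simp: near_def)
  have KI: "compactin unit_interval (tree_set y) \<and> tree_set y \<noteq> {} \<and> tree_set y \<subseteq> {0..1}"
    if "y \<in> tagged_trees w" for y
    using tree_set_KI[OF that] topspace_vietoris[of unit_interval] topspace_KI by auto
  have sub: "\<exists>j. \<forall>y. near j y \<longrightarrow> tree_set y \<subseteq> V" if V: "openin unit_interval V" "tree_set z \<subseteq> V" for V
  proof -
    obtain T where T: "open T" "V = {0..1} \<inter> T"
      using V(1) by (auto simp: openin_open)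
    have "compact (tree_set z)"
      using tree_set_KI[OF z] by (simp add: topspace_KI)
    moreover have "tree_set z \<subseteq> T"
      using V(2) T(2) by blast
    ultimately obtain e where e: "e > 0" "(\<Union>x\<in>tree_set z. ball x e) \<subseteq> T"
      using compact_subset_open_imp_ball_epsilon_subset[OF _ T(1)] by blast
    \<comment> \<open>One half of \<open>e\<close> pays for approximating a point of the closure by
      a node point, the other for moving to an ancestor in the box.\<close>
    obtain j where j: "(1/2 :: real) ^ j < e / 2"
      using real_arch_pow_inv[of "e / 2" "1/2"] e(1) by auto
    have "tree_set y \<subseteq> V" if y: "near j y" for y
    proof
      fix p assume p: "p \<in> tree_set y"
      then have "\<exists>q \<in> node_point ` {t. y t \<noteq> Out}. dist q p < e / 2"
        unfolding tree_set_def closure_approachable using half_gt_zero[OF e(1)] by blast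
      then obtain t where t: "y t \<noteq> Out" "dist (node_point t) p < e / 2"
        by blast
      obtain u s where us: "t = u @ s" "s \<in> node_box j"
          "\<bar>node_point t - node_point s\<bar> \<le> (1/2) ^ j"
        using node_point_near_node_box by blast
      have "z s \<noteq> Out"
        using us y t(1) prefix_closed unfolding near_def by blast
      then have "node_point s \<in> tree_set z"
        unfolding tree_set_def by (intro closure_subset[THEN subsetD] imageI) simp
      moreover have "p \<in> ball (node_point s) e"
        using t(2) us(3) j unfolding mem_ball dist_real_def by linarith
      ultimately have "p \<in> T"
        using e(2) by blast
      then show "p \<in> V"
        using p KI[of y] y T(2) by (auto simp: near_def)
    qed
    then show ?thesis
      by blast
  qed
  have hit: "\<exists>j. \<forall>y. near j y \<longrightarrow> tree_set y \<inter> V \<noteq> {}"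
    if V: "openin unit_interval V" "tree_set z \<inter> V \<noteq> {}" for V
  proof -
    obtain T where T: "open T" "V = {0..1} \<inter> T"
      using V(1) by (auto simp: openin_open)
    then have "T \<inter> closure (node_point ` {s. z s \<noteq> Out}) \<noteq> {}"
      using V(2) by (auto simp: tree_set_def)
    then obtain s where s: "z s \<noteq> Out" "node_point s \<in> T"
      using open_Int_closure_eq_empty[OF T(1)] by blast
    obtain j where j: "s \<in> node_box j"
      using in_some_node_box by blast
    have "node_point s \<in> tree_set y \<inter> V" if "near j y" for y
      using that s j T node_point_unit[of s] closure_subset[of "node_point ` {s. y s \<noteq> Out}"]
      unfolding near_def tree_set_def by blast
    then show ?thesis
      by blast
  qed
  have "generate_topology_on
      ((\<lambda>U. {C. compactin unit_interval C \<and> C \<noteq> {} \<and> C \<subseteq> U}) ` {U. openin unit_interval U} \<union>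
       (\<lambda>U. {C. compactin unit_interval C \<and> C \<noteq> {} \<and> C \<inter> U \<noteq> {}}) ` {U. openin unit_interval U}) U"
    using U(1) unfolding vietoris_def openin_topology_generated_by_iff .
  then have "\<exists>j. \<forall>y. near j y \<longrightarrow> tree_set y \<in> U"
    using U(2)
  proof induction
    case (Int A B)
    then obtain i j where "\<And>y. near i y \<Longrightarrow> tree_set y \<in> A" "\<And>y. near j y \<Longrightarrow> tree_set y \<in> B"
      by blast
    then show ?case
      using near_mono by (intro exI[of _ "max i j"]) (meson IntI max.cobounded1 max.cobounded2)
  next
    case (UN \<K>)
    then show ?case
      by (metis UnionE UnionI)
  next
    case (Basis S)
    then consider V where "openin unit_interval V"
        "S = {C. compactin unit_interval C \<and> C \<noteq> {} \<and> C \<subseteq> V}"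
      | V where "openin unit_interval V"
        "S = {C. compactin unit_interval C \<and> C \<noteq> {} \<and> C \<inter> V \<noteq> {}}"
      by blast
    then show ?case
    proof cases
      case 1
      then obtain j where "\<forall>y. near j y \<longrightarrow> tree_set y \<subseteq> V"
        using sub Basis(2) by blast
      then show ?thesis
        using 1(2) KI unfolding near_def by blast
    next
      case 2
      then obtain j where "\<forall>y. near j y \<longrightarrow> tree_set y \<inter> V \<noteq> {}"
        using hit Basis(2) by blast
      then show ?thesis
        using 2(2) KI unfolding near_def by blast
    qed
  qed simp
  then show ?thesis
    unfolding near_def by blast
qed

section \<open>Trees with ranked root code countable sets\<close>

definition subtree_points :: "(nat list \<Rightarrow> tag) \<Rightarrow> nat list \<Rightarrow> real set" where
  "subtree_points z s = node_point ` {t. z t \<noteq> Out \<and> (\<exists>u. t = u @ s)}"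

lemma subtree_points_subset: "subtree_points z s \<subseteq> node_interval s"
  using node_point_append by (auto simp: subtree_points_def)

text \<open>All children from some \<open>N\<close> on lie in a closed interval to the left of
  \<open>y\<close>, so only finitely many children matter, and closure commutes with finite
  unions.\<close>

lemma closure_subtree_child:
  assumes z: "z \<in> tagged_trees w" and y: "y \<in> closure (subtree_points z s)" "y \<noteq> node_point s"
  shows "\<exists>n. z (n # s) \<noteq> Out \<and> y \<in> closure (subtree_points z (n # s))"
proof -
  have "closure (subtree_points z s) \<subseteq> node_interval s"
    using subtree_points_subset by (intro closure_minimal) (auto simp: node_interval_def)
  then have "0 < y - node_point s"
    using y by (auto simp: node_interval_def)
  then obtain N where "(1/2) ^ N < y - node_point s"
    using real_arch_pow_inv[of "y - node_point s" "1/2"] by auto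
  moreover have "node_width s * (3 / 4) / 2 ^ N \<le> (1/2) ^ N"
  proof -
    have "node_width s * (3 / 4) \<le> 1"
      using node_width_le[of s] power_le_one[of "1/2 :: real" "length s"] node_width_pos[of s]
      by simp
    then show ?thesis
      unfolding power_one_over by (rule divide_right_mono) simp
  qed
  ultimately have N: "node_point s + node_width s * (3 / 4) / 2 ^ N < y"
    by linarith
  let ?I = "{node_point s .. node_point s + node_width s * (3 / 4) / 2 ^ N}"
  have "subtree_points z s \<subseteq> ?I \<union> (\<Union>n<N. subtree_points z (n # s))"
  proof
    fix p assume "p \<in> subtree_points z s"
    then obtain u where u: "p = node_point (u @ s)" "z (u @ s) \<noteq> Out"
      by (auto simp: subtree_points_def)
    show "p \<in> ?I \<union> (\<Union>n<N. subtree_points z (n # s))"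
    proof (cases u rule: rev_cases)
      case Nil
      then show ?thesis
        using u node_width_pos[of s] by simp
    next
      case (snoc v n)
      show ?thesis
      proof (cases "n < N")
        case True
        then show ?thesis
          using u snoc by (auto simp: subtree_points_def)
      next
        case False
        then have "(2::real) ^ N \<le> 2 ^ n"
          by (intro power_increasing) auto
        then have "node_width s * (3 / 4) / 2 ^ n \<le> node_width s * (3 / 4) / 2 ^ N"
          using node_width_pos[of s] by (intro divide_left_mono) auto
        moreover have "p \<in> node_interval (n # s)"
          using u(1) snoc node_point_append[of v "n # s"] by simp
        moreover have "node_point s \<le> node_point (n # s)"
          using node_width_pos[of s] by simp
        ultimately have "p \<in> ?I"
          using child_end[of n s] by (simp add: node_interval_def del: node_point.simps)
        then show ?thesis
          by blast
      qed
    qed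
  qed
  then have "closure (subtree_points z s) \<subseteq> ?I \<union> (\<Union>n<N. closure (subtree_points z (n # s)))"
    using closure_subset by (intro closure_minimal) (blast, auto)
  then obtain n where n: "y \<in> closure (subtree_points z (n # s))"
    using y(1) N by auto
  then have "subtree_points z (n # s) \<noteq> {}"
    by auto
  then have "z (n # s) \<noteq> Out"
    using prefix_closed[OF z] by (auto simp: subtree_points_def)
  then show ?thesis
    using n by blast
qed

text \<open>A point of the closure other than \<open>node_point s\<close> passes to the closure of a
  child's subtree, whose tag is smaller. The nested induction follows the lexicographic order of
  \<open>(\<gamma>, n)\<close>.\<close>

lemma closure_subtree_ranked:
  assumes z: "z \<in> tagged_trees w"
  shows "z s = Fin \<gamma> n \<Longrightarrow> y \<in> closure (subtree_points z s) \<Longrightarrow> y \<in> range node_point"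
proof (induction \<gamma> arbitrary: n s rule: less_induct)
  case outer: (less \<gamma>)
  from outer.prems show ?case
  proof (induction n arbitrary: s rule: less_induct)
    case (less n)
    show ?case
    proof (cases "y = node_point s")
      case False
      then obtain m where m: "z (m # s) \<noteq> Out" "y \<in> closure (subtree_points z (m # s))"
        using closure_subtree_child[OF z less.prems(2)] by blast
      have "tag_less (z (m # s)) (Fin \<gamma> n)"
        using z less.prems(1) unfolding tagged_trees_def by (metis (mono_tags, lifting) mem_Collect_eq)
      then show ?thesis
        using m less.IH outer.IH by (cases "z (m # s)") auto
    qed simp
  qed
qed

lemma tree_set_ranked:
  assumes "z \<in> tagged_trees w" "z [] = Fin \<gamma> n"
  shows "tree_set z \<subseteq> range node_point"
  using closure_subtree_ranked[OF assms] by (auto simp: tree_set_def subtree_points_def)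

section \<open>Generic trees with root tag \<open>Infty\<close> code uncountable sets\<close>

definition splitting :: "nat list \<Rightarrow> (nat list \<Rightarrow> tag) set" where
  "splitting s = {z. z s = Infty \<longrightarrow> (\<exists>a b. a < b \<and> z (a # s) = Infty \<and> z (b # s) = Infty)}"

text \<open>Cantor's diagonal argument: of two disjoint child intervals tagged \<open>Infty\<close>,
  one misses \<open>e n\<close>. The node points along the chosen branch converge to a point of the
  code lying in all chosen intervals, hence not enumerated.\<close>

lemma uncountable_tree_set:
  assumes z: "z [] = Infty" "\<And>s. z \<in> splitting s"
  shows "uncountable (tree_set z)"
proof
  assume c: "countable (tree_set z)"
  have ne: "tree_set z \<noteq> {}"
    using z(1) by (auto simp: tree_set_def intro!: exI[of _ "[]"])
  define e where "e = from_nat_into (tree_set z)"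
  have e: "range e = tree_set z"
    unfolding e_def by (rule range_from_nat_into[OF ne c])
  have "\<exists>\<sigma>. \<forall>n. z (\<sigma> n) = Infty \<and> (e n \<notin> node_interval (\<sigma> (Suc n)) \<and> (\<exists>a. \<sigma> (Suc n) = a # \<sigma> n))"
  proof (rule dependent_nat_choice)
    fix s n assume "z s = Infty"
    then obtain a b where ab: "a < b" "z (a # s) = Infty" "z (b # s) = Infty"
      using z(2)[of s] by (auto simp: splitting_def)
    have "e n \<notin> node_interval (a # s) \<or> e n \<notin> node_interval (b # s)"
      using node_interval_disjoint[OF ab(1)] by blast
    then show "\<exists>t. z t = Infty \<and> e n \<notin> node_interval t \<and> (\<exists>a. t = a # s)"
      using ab by blast
  qed (use z(1) in blast)
  then obtain \<sigma> where \<sigma>: "\<And>n. z (\<sigma> n) = Infty" "\<And>n. e n \<notin> node_interval (\<sigma> (Suc n))"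
      "\<And>n. \<exists>a. \<sigma> (Suc n) = a # \<sigma> n"
    by blast
  have nested: "node_interval (\<sigma> (Suc n)) \<subseteq> node_interval (\<sigma> n)" for n
    using \<sigma>(3)[of n] node_interval_Cons by metis
  have dec: "node_interval (\<sigma> m) \<subseteq> node_interval (\<sigma> n)" if "n \<le> m" for m n
    by (rule lift_Suc_antimono_le[where f = "\<lambda>n. node_interval (\<sigma> n)", OF nested that])
  have "node_point (\<sigma> (Suc n)) \<in> node_interval (\<sigma> n)" for n
    using node_point_in nested by blast
  then have "incseq (\<lambda>n. node_point (\<sigma> n))"
    by (intro incseq_SucI) (simp add: node_interval_def)
  moreover have "\<forall>n. node_point (\<sigma> n) \<le> 1"
    using node_point_unit by simp
  ultimately obtain L where L: "(\<lambda>n. node_point (\<sigma> n)) \<longlonglongrightarrow> L"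
    by (rule incseq_convergent)
  have "L \<in> tree_set z"
    unfolding tree_set_def closure_sequential using L \<sigma>(1)
    by (intro exI[of _ "\<lambda>n. node_point (\<sigma> n)"]) auto
  then obtain n where n: "L = e n"
    using e by blast
  have "L \<in> node_interval (\<sigma> (Suc n))"
  proof (rule Lim_in_closed_set[OF _ _ _ L])
    show "\<forall>\<^sub>F m in sequentially. node_point (\<sigma> m) \<in> node_interval (\<sigma> (Suc n))"
      using dec node_point_in by (intro eventually_sequentiallyI[of "Suc n"]) blast
  qed (auto simp: node_interval_def)
  then show False
    using \<sigma>(2) n by blast
qed

text \<open>A cylinder fixing a tag other than \<open>Infty\<close> at \<open>s\<close> satisfies
  the condition vacuously. Otherwise two new children can be tagged \<open>Infty\<close>.\<close>

lemma dense_in_splitting: "dense_in w (splitting s)"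
  unfolding dense_in_def
proof (intro ballI allI)
  fix x k assume x: "x \<in> tagged_trees w"
  obtain j0 where "s \<in> node_box j0"
    using in_some_node_box by blast
  then obtain j where j: "k \<le> j" "s \<in> node_box j"
    using node_box_mono[of j0 "max j0 k"] by (meson max.cobounded1 max.cobounded2 subsetD)
  show "\<exists>y\<in>cyl w x k. \<exists>i\<ge>k. cyl w y i \<subseteq> splitting s"
  proof (cases "x s = Infty")
    case False
    then have "cyl w x j \<subseteq> splitting s"
      using j by (auto simp: cyl_def splitting_def)
    then show ?thesis
      using j cyl_refl[OF x] by blast
  next
    case True
    \<comment> \<open>The entries \<open>j\<close> and \<open>Suc j\<close> are too large for box
      \<open>j\<close>, so these children are still free; box \<open>j + 2\<close> contains
      both.\<close>
    define y where "y t = (if t \<in> node_box j then x t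
      else if t = j # s \<or> t = Suc j # s then Infty else Out)" for t
    have "tag_less (y (n # t)) (y t)" for n t
    proof (cases "n # t \<in> node_box j")
      case inside: True
      then show ?thesis
        using x node_box_tail[OF inside] by (simp add: y_def tagged_trees_def)
    next
      case False
      then show ?thesis
        using True j(2) by (auto simp: y_def)
    qed
    then have "y \<in> cyl w x j"
      using x by (auto simp: cyl_def tagged_trees_def y_def)
    then have "y \<in> cyl w x k"
      using cyl_mono[OF cyl_refl[OF x]] j(1) by blast
    moreover have "j # s \<notin> node_box j" "Suc j # s \<notin> node_box j"
      by (auto simp: node_box_def)
    moreover have "j # s \<in> node_box (j + 2)" "Suc j # s \<in> node_box (j + 2)"
      using j(2) by (auto simp: node_box_def)
    ultimately show ?thesis
      using j(1)
      by (intro bexI[of _ y] exI[of _ "j + 2"]) (auto simp: cyl_def splitting_def y_def)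
  qed
qed


section \<open>Forcing and the Borel hierarchy\<close>

lemma forces_cyl_cong:
  assumes "\<And>z. z \<in> tagged_trees w \<Longrightarrow> z \<in> S \<longleftrightarrow> z \<in> S'"
  shows "forces w (cyl w x k) S \<longleftrightarrow> forces w (cyl w x k) S'"
proof -
  have "cyl w x k \<inter> A \<subseteq> S \<longleftrightarrow> cyl w x k \<inter> A \<subseteq> S'" for A
    using assms cyl_tagged by blast
  then show ?thesis
    unfolding forces_def by simp
qed

lemma forces_vimage_Compl:
  "forces w (cyl w x k) (tree_set -` (topspace KI - A)) \<longleftrightarrow>
   forces w (cyl w x k) (- (tree_set -` A))"
  using tree_set_KI by (intro forces_cyl_cong) auto

text \<open>By continuity of the code, a tree in the cylinder with code in \<open>U\<close> has a
  whole cylinder of them around it; without such a tree the cylinder avoids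
  \<open>U\<close>.\<close>

lemma decided_open:
  assumes "openin KI U"
  shows "decided w (tree_set -` U)"
  unfolding decided_def
proof (intro ballI allI)
  fix x k assume x: "x \<in> tagged_trees w"
  show "\<exists>y\<in>cyl w x k. \<exists>j\<ge>k. forces w (cyl w y j) (tree_set -` U) \<or>
      forces w (cyl w y j) (- (tree_set -` U))"
  proof (cases "\<exists>y\<in>cyl w x k. tree_set y \<in> U")
    case True
    then obtain y where y: "y \<in> cyl w x k" "tree_set y \<in> U"
      by blast
    obtain j where j: "\<forall>z\<in>tagged_trees w. (\<forall>s\<in>node_box j. z s = Out \<longleftrightarrow> y s = Out) \<longrightarrow> tree_set z \<in> U"
      using tree_set_openin[OF cyl_tagged[OF y(1)] assms y(2)] by blast
    have "cyl w y (max j k) \<subseteq> tree_set -` U"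
      using j node_box_mono[of j "max j k"] by (auto simp: cyl_def subset_iff)
    then show ?thesis
      using y(1) forces_subset by (meson max.cobounded2)
  next
    case False
    then have "cyl w x k \<subseteq> - (tree_set -` U)"
      by blast
    then show ?thesis
      using cyl_refl[OF x] forces_subset by blast
  qed
qed

text \<open>Preimages of Borel sets under the coding map have the property of Baire, by simultaneous
  induction on the hierarchy.\<close>

lemma decided_Borel:
  "Sigma0 KI \<beta> S \<Longrightarrow> decided w (tree_set -` S)"
  "Pi0 KI \<beta> S \<Longrightarrow> decided w (tree_set -` S)"
proof (induction rule: Sigma0_Pi0.inducts)
  case (Sigma0_open U)
  then show ?case
    by (rule decided_open)
next
  case (Sigma0_Union \<alpha> \<beta> A)
  then show ?case
    unfolding vimage_UN by (intro decided_UN) blast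
next
  case (Pi0_compl \<alpha> A)
  have "forces w (cyl w x k) (- (tree_set -` (topspace KI - A))) \<longleftrightarrow> forces w (cyl w x k) (tree_set -` A)"
    for x k
    using tree_set_KI by (intro forces_cyl_cong) auto
  then show ?case
    using Pi0_compl.IH unfolding decided_def forces_vimage_Compl by blast
qed

text \<open>A tree \<open>y\<close> below \<open>x'\<close> with code in \<open>U\<close> could be
  retagged to one below \<open>x\<close> with the same nodes in a large box. By continuity its whole
  cylinder would have codes in \<open>U\<close>, against \<open>f\<close>.\<close>

lemma forces_open_transfer:
  assumes U: "openin KI U"
    and x: "x \<in> tagged_trees w" "\<And>s. s \<in> node_box k \<Longrightarrow> tag_sim 1 (x s) (x' s)" "1 \<le> w"
    and f: "forces w (cyl w x k) (- (tree_set -` U))"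
  shows "cyl w x' k \<subseteq> - (tree_set -` U)"
proof (rule ccontr)
  assume "\<not> ?thesis"
  then obtain y where y: "y \<in> cyl w x' k" "tree_set y \<in> U"
    by blast
  obtain j0 where j0: "\<forall>z\<in>tagged_trees w. (\<forall>s\<in>node_box j0. z s = Out \<longleftrightarrow> y s = Out) \<longrightarrow> tree_set z \<in> U"
    using tree_set_openin[OF cyl_tagged[OF y(1)] U y(2)] by blast
  define j where "j = max j0 k"
  have "(0::omega1) < 1"
    using one_le_omega1_iff[of 1] zero_le_omega1[of 1] by auto
  then obtain z where z: "z \<in> cyl w x k" "\<forall>s\<in>node_box j. tag_sim 0 (z s) (y s)"
    using retag[OF x(1) y(1) x(2), of 0 j] x(3) by (auto simp: j_def)
  have "tree_set v \<in> U" if v: "v \<in> cyl w z j" for v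
  proof -
    have "v s = Out \<longleftrightarrow> y s = Out" if "s \<in> node_box j0" for s
    proof -
      have "s \<in> node_box j"
        using that node_box_mono[of j0 j] by (auto simp: j_def)
      then show ?thesis
        using v z(2) tag_sim_Out[of 0 "z s" "y s"] by (simp add: cyl_def)
    qed
    then show ?thesis
      using j0 v cyl_tagged by blast
  qed
  moreover have "forces w (cyl w z j) (- (tree_set -` U))"
    using forces_mono[OF f cyl_mono[OF z(1)]] by (simp add: j_def)
  ultimately show False
    using forces_nonempty[OF cyl_tagged[OF z(1)]] by (meson ComplD vimageI2)
qed

text \<open>If \<open>x'\<close> fails, some extension \<open>y\<close> of it forces an
  \<open>A n\<close>. Retagging gives \<open>z\<close> below \<open>x\<close>, similar to
  \<open>y\<close> at level \<open>\<beta> n\<close>, so \<open>z\<close> forces \<open>A n\<close>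
  by \<open>IH\<close> while inheriting its complement from \<open>x\<close>. This contradicts the
  Baire category theorem.\<close>

lemma forces_Union_transfer:
  assumes dec: "\<And>n::nat. decided w (A n)"
    and \<beta>: "\<And>n. \<beta> n < \<alpha>" "\<alpha> \<le> w"
    and IH: "\<And>n y z j. y \<in> tagged_trees w \<Longrightarrow> z \<in> tagged_trees w \<Longrightarrow>
      (\<forall>s\<in>node_box j. tag_sim (\<beta> n) (y s) (z s)) \<Longrightarrow>
      forces w (cyl w y j) (A n) \<Longrightarrow> forces w (cyl w z j) (A n)"
    and x: "x \<in> tagged_trees w" "\<And>s. s \<in> node_box k \<Longrightarrow> tag_sim \<alpha> (x s) (x' s)"
    and f: "forces w (cyl w x k) (- (\<Union>n. A n))"
  shows "forces w (cyl w x' k) (- (\<Union>n. A n))"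
proof -
  have "forces w (cyl w x' k) (- A n)" for n
  proof (rule ccontr)
    assume "\<not> ?thesis"
    then obtain y j where y: "y \<in> cyl w x' k" "k \<le> j" "forces w (cyl w y j) (A n)"
      using not_forces_Compl[OF dec] by blast
    obtain z where z: "z \<in> cyl w x k" "\<forall>s\<in>node_box j. tag_sim (\<beta> n) (z s) (y s)"
      using retag[OF x(1) y(1) x(2) \<beta>(1) \<beta>(2) y(2)] by blast
    have "forces w (cyl w z j) (A n)"
      using z(2) tag_sim_sym by (intro IH[OF cyl_tagged[OF y(1)] cyl_tagged[OF z(1)] _ y(3)]) blast
    moreover have "forces w (cyl w z j) (- (\<Union>n. A n))"
      using forces_mono[OF f cyl_mono[OF z(1) y(2)]] by simp
    ultimately have "forces w (cyl w z j) (A n \<inter> - (\<Union>n. A n))"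
      by (rule forces_Int)
    then show False
      using forces_nonempty[OF cyl_tagged[OF z(1)]] by blast
  qed
  then have "forces w (cyl w x' k) (\<Inter>n. - A n)"
    by (intro forces_INT) auto
  then show ?thesis
    by simp
qed

text \<open>Steel's retagging lemma. The first clause is stated for complements, so that both
  clauses concern forcing a Pi condition of the same level.\<close>

lemma forces_Borel_transfer:
  "Sigma0 KI \<beta> S \<Longrightarrow> (\<And>x x' k. \<beta> \<le> w \<Longrightarrow> x \<in> tagged_trees w \<Longrightarrow> x' \<in> tagged_trees w \<Longrightarrow>
     (\<forall>s\<in>node_box k. tag_sim \<beta> (x s) (x' s)) \<Longrightarrow>
     forces w (cyl w x k) (- (tree_set -` S)) \<Longrightarrow> forces w (cyl w x' k) (- (tree_set -` S)))"
  "Pi0 KI \<beta> S \<Longrightarrow> (\<And>x x' k. \<beta> \<le> w \<Longrightarrow> x \<in> tagged_trees w \<Longrightarrow> x' \<in> tagged_trees w \<Longrightarrow>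
     (\<forall>s\<in>node_box k. tag_sim \<beta> (x s) (x' s)) \<Longrightarrow>
     forces w (cyl w x k) (tree_set -` S) \<Longrightarrow> forces w (cyl w x' k) (tree_set -` S))"
proof (induction rule: Sigma0_Pi0.inducts)
  case (Sigma0_open U)
  then show ?case
    using forces_open_transfer[of U x w k x'] forces_subset by blast
next
  case (Sigma0_Union \<alpha> \<beta> A)
  have "forces w (cyl w x' k) (- (\<Union>n. tree_set -` A n))"
  proof (rule forces_Union_transfer)
    show "decided w (tree_set -` A n)" for n
      using Sigma0_Union.IH decided_Borel(2) by blast
    show "\<beta> n < \<alpha>" for n
      using Sigma0_Union.IH by blast
    show "forces w (cyl w z j) (tree_set -` A n)"
      if "y \<in> tagged_trees w" "z \<in> tagged_trees w" "\<forall>s\<in>node_box j. tag_sim (\<beta> n) (y s) (z s)"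
        "forces w (cyl w y j) (tree_set -` A n)" for n y z j
      using that Sigma0_Union.IH[of n] Sigma0_Union.prems(1) by (meson less_le_trans less_imp_le)
    show "forces w (cyl w x k) (- (\<Union>n. tree_set -` A n))"
      using Sigma0_Union.prems by (simp add: vimage_UN)
  qed (use Sigma0_Union.prems in auto)
  then show ?case
    by (simp add: vimage_UN)
next
  case (Pi0_compl \<alpha> A)
  then show ?case
    unfolding forces_vimage_Compl by blast
qed


section \<open>Selectors\<close>

text \<open>All codes in the cylinder consist of node points, so countably many fibres of
  \<open>f\<close> cover it and one of them is not meagre. Fibres are Pi sets because the complement
  of a point is open, so some extension forces that fibre.\<close>

lemma generic_value:
  assumes rank: "borel_rank_le KI unit_interval \<alpha> f" and sel: "\<forall>C\<in>topspace KI. f C \<in> C"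
    and x: "x \<in> tagged_trees \<alpha>" "x [] = Fin \<gamma> m"
  obtains y j s where "y \<in> cyl \<alpha> x 0"
    "forces \<alpha> (cyl \<alpha> y j) (tree_set -` {C \<in> topspace KI. f C = node_point s})"
    "Pi0 KI \<alpha> {C \<in> topspace KI. f C = node_point s}"
proof -
  have Pi0: "Pi0 KI \<alpha> {C \<in> topspace KI. f C = node_point s}" for s
  proof -
    have "openin unit_interval ({0..1} - {node_point s})"
      by (simp add: openin_delete)
    then have "Sigma0 KI \<alpha> (f -` ({0..1} - {node_point s}) \<inter> topspace KI)"
      using rank unfolding borel_rank_le_def by blast
    then have "Pi0 KI \<alpha> (topspace KI - (f -` ({0..1} - {node_point s}) \<inter> topspace KI))"
      by (rule Pi0_compl)
    moreover have "topspace KI - (f -` ({0..1} - {node_point s}) \<inter> topspace KI) =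
        {C \<in> topspace KI. f C = node_point s}"
      using sel by (auto simp: topspace_KI)
    ultimately show ?thesis
      by simp
  qed
  have "\<exists>s. \<not> forces \<alpha> (cyl \<alpha> x 0) (- (tree_set -` {C \<in> topspace KI. f C = node_point s}))"
  proof (rule ccontr)
    assume "\<not> ?thesis"
    then have "forces \<alpha> (cyl \<alpha> x 0)
        (\<Inter>s. - (tree_set -` {C \<in> topspace KI. f C = node_point s}))"
      by (intro forces_INT) auto
    from forces_nonempty[OF x(1) this] obtain z where z: "z \<in> cyl \<alpha> x 0"
        "\<And>s. z \<notin> tree_set -` {C \<in> topspace KI. f C = node_point s}"
      by (elim bexE) (simp only: INT_iff Compl_iff, blast)
    have KI: "tree_set z \<in> topspace KI"
      using tree_set_KI[OF cyl_tagged[OF z(1)]] .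
    have "z [] = Fin \<gamma> m"
      using z(1) x(2) by (simp add: cyl_def)
    then have "tree_set z \<subseteq> range node_point"
      by (rule tree_set_ranked[OF cyl_tagged[OF z(1)]])
    then have "f (tree_set z) \<in> range node_point"
      using sel KI by blast
    then show False
      using z(2) KI by auto
  qed
  then show thesis
    using not_forces_Compl[OF decided_Borel(2)[OF Pi0]] Pi0 that by blast
qed

theorem mainTheorem2:
  shows "\<not> (\<exists>(\<alpha> :: omega1) (F :: (real set \<Rightarrow> real) set).
    1 \<le> \<alpha> \<and> uncountable F \<and>
    F \<subseteq> (topspace KI \<rightarrow>\<^sub>E topspace unit_interval) \<and>
    (\<forall>f\<in>F. f \<in> borel_algebra KI \<rightarrow>\<^sub>M borel_algebra unit_interval \<and>
            borel_rank_le KI unit_interval \<alpha> f) \<and>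
    (\<forall>f\<in>F. \<forall>C\<in>topspace KI. f C \<in> C) \<and>
    (\<forall>f\<in>F. \<forall>g\<in>F. f \<noteq> g \<longrightarrow> (\<forall>C\<in>topspace KI. uncountable C \<longrightarrow> f C \<noteq> g C)))"
proof (rule notI, elim exE conjE)
  fix \<alpha> :: omega1 and F :: "(real set \<Rightarrow> real) set"
  assume F: "uncountable F"
    and meas: "\<forall>f\<in>F. f \<in> borel_algebra KI \<rightarrow>\<^sub>M borel_algebra unit_interval \<and>
            borel_rank_le KI unit_interval \<alpha> f"
    and sel: "\<forall>f\<in>F. \<forall>C\<in>topspace KI. f C \<in> C"
    and dist: "\<forall>f\<in>F. \<forall>g\<in>F. f \<noteq> g \<longrightarrow> (\<forall>C\<in>topspace KI. uncountable C \<longrightarrow> f C \<noteq> g C)"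
  \<comment> \<open>The root tag \<open>\<omega> \<cdot> \<alpha>\<close> is an ordinal, so codes
    below this condition are countable, yet it is related to \<open>Infty\<close> at level
    \<open>\<alpha>\<close>. At level \<open>0\<close> a cylinder fixes the root tag only.\<close>
  define x where "x s = (if s = [] then Fin \<alpha> 0 else Out)" for s :: "nat list"
  have x: "x \<in> tagged_trees \<alpha>" "x [] = Fin \<alpha> 0"
    by (auto simp: x_def tagged_trees_def)
  define S where "S f s = {C \<in> topspace KI. f C = node_point s}" for f s
  have "\<exists>p. \<forall>f\<in>F. fst (p f) \<in> cyl \<alpha> x 0 \<and>
      forces \<alpha> (cyl \<alpha> (fst (p f)) (fst (snd (p f)))) (tree_set -` S f (snd (snd (p f)))) \<and>
      Pi0 KI \<alpha> (S f (snd (snd (p f))))"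
  proof (rule bchoice, rule ballI)
    fix f assume f: "f \<in> F"
    have "borel_rank_le KI unit_interval \<alpha> f" "\<forall>C\<in>topspace KI. f C \<in> C"
      using meas sel f by blast+
    then obtain y j s where "y \<in> cyl \<alpha> x 0" "forces \<alpha> (cyl \<alpha> y j) (tree_set -` S f s)"
        "Pi0 KI \<alpha> (S f s)"
      unfolding S_def by (rule generic_value[OF _ _ x])
    then show "\<exists>q. fst q \<in> cyl \<alpha> x 0 \<and>
        forces \<alpha> (cyl \<alpha> (fst q) (fst (snd q))) (tree_set -` S f (snd (snd q))) \<and>
        Pi0 KI \<alpha> (S f (snd (snd q)))"
      by (intro exI[of _ "(y, j, s)"]) simp
  qed
  then obtain p where p: "\<forall>f\<in>F. fst (p f) \<in> cyl \<alpha> x 0 \<and>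
      forces \<alpha> (cyl \<alpha> (fst (p f)) (fst (snd (p f)))) (tree_set -` S f (snd (snd (p f)))) \<and>
      Pi0 KI \<alpha> (S f (snd (snd (p f))))"
    by blast
  \<comment> \<open>Pigeonhole: there are countably many pairs of a cylinder and a node, so two
    selectors share one.\<close>
  define c where "c f = (cyl \<alpha> (fst (p f)) (fst (snd (p f))), snd (snd (p f)))" for f
  have "c ` F \<subseteq> {W. \<exists>x\<in>tagged_trees \<alpha>. \<exists>k. W = cyl \<alpha> x k} \<times> UNIV"
    unfolding c_def using p cyl_tagged by blast
  then have "countable (c ` F)"
    using countable_cyls by (meson countable_SIGMA countableI_type countable_subset)
  then have "\<not> inj_on c F"
    using F countable_image_inj_on by blast
  then obtain f g where fg: "f \<in> F" "g \<in> F" "f \<noteq> g" "c f = c g"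
    unfolding inj_on_def by blast
  obtain y j s where y: "p f = (y, j, s)"
    by (metis prod_cases3)
  have yx: "y \<in> cyl \<alpha> x 0" and Pf: "Pi0 KI \<alpha> (S f s)" and Pg: "Pi0 KI \<alpha> (S g s)"
    and ff: "forces \<alpha> (cyl \<alpha> y j) (tree_set -` S f s)"
    and fgg: "forces \<alpha> (cyl \<alpha> y j) (tree_set -` S g s)"
    using p[rule_format, OF fg(1)] p[rule_format, OF fg(2)] fg(4) y by (auto simp: c_def)
  \<comment> \<open>This stays a tagged tree: a node above one with a replaced tag is itself
    replaced, and \<open>Infty\<close> may lie below \<open>Infty\<close>.\<close>
  define y' where "y' t = (if tag_ge \<alpha> (y t) then Infty else y t)" for t
  have yT: "y \<in> tagged_trees \<alpha>"
    using cyl_tagged[OF yx] .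
  have "tag_less (y' (n # t)) (y' t)" for n t
  proof -
    have "tag_less (y (n # t)) (y t)"
      using yT by (simp add: tagged_trees_def)
    then show ?thesis
      by (cases "y (n # t)"; cases "y t") (auto simp: y'_def)
  qed
  then have y'T: "y' \<in> tagged_trees \<alpha>"
    using yT by (auto simp: tagged_trees_def y'_def)
  have sim: "\<forall>t\<in>node_box j. tag_sim \<alpha> (y t) (y' t)"
    by (simp add: y'_def tag_sim_def)
  have "y [] = Fin \<alpha> 0"
    using yx x(2) by (simp add: cyl_def)
  then have root: "y' [] = Infty"
    by (simp add: y'_def)
  \<comment> \<open>A tree that splits at all nodes and also lies in both transferred fibres has an
    uncountable code on which \<open>f\<close> and \<open>g\<close> agree.\<close>
  have "forces \<alpha> (cyl \<alpha> y' j) (\<Inter>t. splitting t)"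
    unfolding forces_def using dense_in_splitting
    by (intro exI[of _ "range splitting"]) auto
  then have "forces \<alpha> (cyl \<alpha> y' j) ((tree_set -` S f s \<inter> tree_set -` S g s) \<inter> (\<Inter>t. splitting t))"
    using forces_Borel_transfer(2)[OF Pf order_refl yT y'T sim ff]
      forces_Borel_transfer(2)[OF Pg order_refl yT y'T sim fgg]
    by (intro forces_Int)
  from forces_nonempty[OF y'T this] obtain z where z: "z \<in> cyl \<alpha> y' j"
      "tree_set z \<in> S f s" "tree_set z \<in> S g s" "\<And>t. z \<in> splitting t"
    by (elim bexE) (simp only: Int_iff INT_iff vimage_eq, blast)
  have "z [] = Infty"
    using z(1) root by (simp add: cyl_def)
  then have "uncountable (tree_set z)"
    using z(4) by (rule uncountable_tree_set)
  moreover have "tree_set z \<in> topspace KI" "f (tree_set z) = g (tree_set z)"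
    using z(2,3) by (auto simp: S_def)
  ultimately show False
    using dist fg(1-3) by blast
qed

end
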